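(* Fix $\alpha\in[0,1]$. If $Z=(Z_1,\dots,Z_{n+1})\in\mathcal{Z}^{n+1}$, with $Z_i=(X_i,Y_i)$, has density $f$ with respect to an exchangeable base measure, then for any score function $\mathsf{s}:\mathcal{Z}\times\mathcal{Z}^{n+1}\to\mathbb{R}$ (not necessarily symmetric in its second argument), the generalized weighted conformal prediction set $$\mathcal{C}(X_{n+1})=\bigg\{y\in\mathcal{Y}:S^y_{\mathrm{id}}\le\mathrm{Quantile}_{1-\alpha}\bigg(\frac{\sum_{\sigma\in\mathcal{S}_{n+1}}\frac{f(Z^y_\sigma)}{f(Z^y)}\,\delta_{S^y_\sigma}}{\sum_{\sigma\in\mathcal{S}_{n+1}}\frac{f(Z^y_\sigma)}{f(Z^y)}}\bigg)\bigg\}$$ satisfies $\mathbb{P}\{Y_{n+1}\in\mathcal{C}(X_{n+1})\}\ge1-\alpha$.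
   Context: $\mathcal{X},\mathcal{Y}$ are measurable spaces, $\mathcal{Z}=\mathcal{X}\times\mathcal{Y}$, $n\ge1$, and all functions are measurable. $\mathcal{S}_{n+1}$ is the set of permutations of $\{1,\dots,n+1\}$ and $\mathrm{id}$ is the identity permutation. For $z\in\mathcal{Z}^{n+1}$ and $\sigma\in\mathcal{S}_{n+1}$, $z_\sigma=(z_{\sigma(1)},\dots,z_{\sigma(n+1)})$. An exchangeable base measure on $\mathcal{Z}^{n+1}$ is one that is invariant under all maps $z\mapsto z_\sigma$. The density $f$ is assumed to be strictly positive everywhere, so that the ratios are well-defined. For $y\in\mathcal{Y}$, let $Z^y=(Z_1,\dots,Z_n,(X_{n+1},y))$, with permuted version $Z^y_\sigma=(Z^y_{\sigma(1)},\dots,Z^y_{\sigma(n+1)})$, and $S^y_\sigma=\mathsf{s}(Z^y_{\sigma(n+1)},Z^y_\sigma)$ for $\sigma\in\mathcal{S}_{n+1}$. $\delta_v$ is the point mass at $v$, and $\mathrm{Quantile}_\tau(P)=\inf\{x\in\mathbb{R}:\mathbb{P}_{V\sim P}\{V\le x\}\ge\tau\}$. *)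

theory Defs
  imports "HOL-Probability.Probability" "HOL-Combinatorics.Permutations"
begin

text \<open>
  Elements of \<open>\<Z>\<^sup>n\<^sup>+\<^sup>1\<close> are functions in \<open>space (PiM {1..n+1} (\<lambda>_. N))\<close>, i.e. they are
  \<open>undefined\<close> outside of \<open>{1..n+1}\<close>; this is why the operations below restrict their results.
\<close>

definition permute_vec :: "nat \<Rightarrow> (nat \<Rightarrow> nat) \<Rightarrow> (nat \<Rightarrow> 'z) \<Rightarrow> nat \<Rightarrow> 'z" where
  "permute_vec n \<sigma> z = (\<lambda>i\<in>{1..n+1}. z (\<sigma> i))"

definition exchangeable_measure :: "nat \<Rightarrow> 'z measure \<Rightarrow> (nat \<Rightarrow> 'z) measure \<Rightarrow> bool" where
  "exchangeable_measure n N \<mu> \<longleftrightarrow>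
     sets \<mu> = sets (PiM {1..n+1} (\<lambda>_. N)) \<and>
     (\<forall>\<sigma>. \<sigma> permutes {1..n+1} \<longrightarrow> distr \<mu> \<mu> (permute_vec n \<sigma>) = \<mu>)"

definition weighted_point_masses :: "'i set \<Rightarrow> ('i \<Rightarrow> real) \<Rightarrow> ('i \<Rightarrow> real) \<Rightarrow> real measure" where
  "weighted_point_masses I w v =
     measure_of UNIV (sets borel)
       (\<lambda>B. \<Sum>i\<in>I. ennreal (w i / (\<Sum>j\<in>I. w j)) * emeasure (return borel (v i)) B)"

lemma space_weighted_point_masses [simp]: "space (weighted_point_masses I w v) = UNIV"
  and sets_weighted_point_masses [simp]: "sets (weighted_point_masses I w v) = sets borel"
  unfolding weighted_point_masses_def
  using sets.sets_measure_of_eq[of "borel :: real measure"]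
  by (simp_all add: space_measure_of_conv)

lemma emeasure_weighted_point_masses:
  assumes "B \<in> sets borel"
  shows "emeasure (weighted_point_masses I w v) B =
    (\<Sum>i\<in>I. ennreal (w i / (\<Sum>j\<in>I. w j)) * emeasure (return borel (v i)) B)"
    (is "_ = ?m B")
proof (rule emeasure_measure_of[OF weighted_point_masses_def])
  show "positive (sets (weighted_point_masses I w v)) ?m"
    by (simp add: positive_def)
  show "countably_additive (sets (weighted_point_masses I w v)) ?m"
  proof (rule countably_additiveI)
    fix A :: "nat \<Rightarrow> real set"
    assume A: "range A \<subseteq> sets (weighted_point_masses I w v)" "disjoint_family A"
    then have "(\<Sum>k. emeasure (return borel (v i)) (A k)) =
        emeasure (return borel (v i)) (\<Union>k. A k)" for i
      by (intro suminf_emeasure) auto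
    then show "(\<Sum>k. ?m (A k)) = ?m (\<Union>k. A k)"
      by (simp add: suminf_sum)
  qed
qed (use assms in auto)

lemma prob_space_weighted_point_masses:
  assumes "finite I" "I \<noteq> {}" "\<And>i. i \<in> I \<Longrightarrow> w i > 0"
  shows "prob_space (weighted_point_masses I w v)"
proof
  have pos: "(\<Sum>j\<in>I. w j) > 0"
    using assms by (intro sum_pos) auto
  have "emeasure (weighted_point_masses I w v) UNIV = (\<Sum>i\<in>I. ennreal (w i / (\<Sum>j\<in>I. w j)))"
    by (simp add: emeasure_weighted_point_masses)
  also have "\<dots> = ennreal (\<Sum>i\<in>I. w i / (\<Sum>j\<in>I. w j))"
    using pos assms by (intro sum_ennreal divide_nonneg_pos) (auto intro: less_imp_le)
  also have "(\<Sum>i\<in>I. w i / (\<Sum>j\<in>I. w j)) = 1"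
    using pos by (subst sum_divide_distrib[symmetric]) simp
  finally show "emeasure (weighted_point_masses I w v) (space (weighted_point_masses I w v)) = 1"
    by simp
qed

text \<open>
  The infimum is taken in the extended reals: for \<open>\<tau> = 0\<close> the set is all of \<open>\<real>\<close> and the
  quantile is \<open>-\<infinity>\<close>.
\<close>

definition quantile :: "real \<Rightarrow> real measure \<Rightarrow> ereal" where
  "quantile \<tau> P = Inf (ereal ` {x. measure P {..x} \<ge> \<tau>})"

text \<open>Only the entries \<open>1, \<dots>, n\<close> of \<open>z\<close> are used; the last entry becomes \<open>(x, y)\<close>.\<close>

definition augment :: "nat \<Rightarrow> (nat \<Rightarrow> 'x \<times> 'y) \<Rightarrow> 'x \<Rightarrow> 'y \<Rightarrow> nat \<Rightarrow> 'x \<times> 'y" where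
  "augment n z x y = (restrict z {1..n})(n + 1 := (x, y))"

definition perm_score ::
  "nat \<Rightarrow> ('z \<Rightarrow> (nat \<Rightarrow> 'z) \<Rightarrow> real) \<Rightarrow> (nat \<Rightarrow> 'z) \<Rightarrow> (nat \<Rightarrow> nat) \<Rightarrow> real" where
  "perm_score n s z \<sigma> = s (permute_vec n \<sigma> z (n + 1)) (permute_vec n \<sigma> z)"

definition conformal_set ::
  "nat \<Rightarrow> 'y measure \<Rightarrow> ((nat \<Rightarrow> 'x \<times> 'y) \<Rightarrow> real) \<Rightarrow>
   ('x \<times> 'y \<Rightarrow> (nat \<Rightarrow> 'x \<times> 'y) \<Rightarrow> real) \<Rightarrow> real \<Rightarrow> (nat \<Rightarrow> 'x \<times> 'y) \<Rightarrow> 'x \<Rightarrow> 'y set" where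
  "conformal_set n MY f s \<alpha> z x =
     {y \<in> space MY. let zy = augment n z x y in
        ereal (perm_score n s zy id) \<le>
        quantile (1 - \<alpha>)
          (weighted_point_masses {\<sigma>. \<sigma> permutes {1..n+1}}
             (\<lambda>\<sigma>. f (permute_vec n \<sigma> zy) / f zy) (perm_score n s zy))}"

end

theory Submission
  imports Defs
begin

text \<open>
  Write \<open>z\<^sub>\<sigma>\<close> for \<open>permute_vec n \<sigma> z\<close> and let \<open>v(z)\<close> be the score of the last entry of \<open>z\<close>
  relative to \<open>z\<close>. Everything in the prediction set is then a function of the orbit of \<open>z\<close>: the
  scores are \<open>v(z\<^sub>\<sigma>)\<close> and the weights are proportional to \<open>f(z\<^sub>\<sigma>)\<close>. Since
  \<open>(z\<^sub>\<sigma>)\<^sub>\<tau> = z\<^bsub>\<sigma> \<circ> \<tau>\<^esub>\<close>, replacing \<open>z\<close> by \<open>z\<^sub>\<sigma>\<close> only relabels the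
  orbit, so the quantile is the same for all points of an orbit.

  Conditionally on its orbit, \<open>Z\<close> is the point \<open>z\<^sub>\<sigma>\<close> with probability proportional to
  \<open>f(z\<^sub>\<sigma>)\<close>, because the base measure gives the orbit points equal mass. Its score is thus a draw
  from precisely the weighted distribution whose quantile is used as threshold, and such a draw
  is at most the \<open>(1 - \<alpha>)\<close>-quantile with probability at least \<open>1 - \<alpha>\<close>.

  No conditional distribution is needed to make this precise: invariance of the base measure
  allows every integral over \<open>z\<close> to be replaced by the average of the integrals over \<open>z\<^sub>\<sigma>\<close>
  (\<open>emeasure_density_ge_of_orbit_bound\<close>), which leaves an inequality between finite sums
  over one orbit (\<open>sum_weights_below_level_ge\<close>). The quantile itself is eliminated
  at the start: \<open>t\<close> is at most the \<open>\<tau>\<close>-quantile of a finite distribution iff the mass strictly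
  below \<open>t\<close> is less than \<open>\<tau>\<close> (\<open>le_quantile_weighted_point_masses_iff\<close>). This form
  also shows that the coverage event is measurable.
\<close>

section \<open>Quantiles of finitely supported distributions\<close>

lemma measure_weighted_point_masses_atMost:
  assumes "finite I" "\<And>i. i \<in> I \<Longrightarrow> w i > 0"
  shows "measure (weighted_point_masses I w v) {..x} =
    (\<Sum>i\<in>I. if v i \<le> x then w i else 0) / (\<Sum>i\<in>I. w i)"
proof -
  have W: "(\<Sum>i\<in>I. w i) \<ge> 0"
    using assms by (intro sum_nonneg) (auto intro: less_imp_le)
  have nonneg: "(if v i \<le> x then w i else 0) / (\<Sum>i\<in>I. w i) \<ge> 0" if "i \<in> I" for i
    using W assms(2)[OF that] by auto
  have "emeasure (weighted_point_masses I w v) {..x} =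
      (\<Sum>i\<in>I. ennreal ((if v i \<le> x then w i else 0) / (\<Sum>i\<in>I. w i)))"
    by (subst emeasure_weighted_point_masses) (auto intro!: sum.cong)
  also have "\<dots> = ennreal (\<Sum>i\<in>I. (if v i \<le> x then w i else 0) / (\<Sum>i\<in>I. w i))"
    using nonneg by (rule sum_ennreal)
  finally show ?thesis
    using sum_nonneg[of I, OF nonneg] by (simp add: measure_def sum_divide_distrib)
qed

text \<open>
  If the mass strictly below \<open>t\<close> already reaches \<open>\<tau>\<close>, it is all collected at the largest
  atom below \<open>t\<close>, which bounds the quantile away from \<open>t\<close>. When there is no such atom,
  \<open>\<tau> \<le> 0\<close> and the quantile is \<open>-\<infinity>\<close>.
\<close>

lemma le_quantile_weighted_point_masses_iff:
  assumes "finite I" "I \<noteq> {}" and pos: "\<And>i. i \<in> I \<Longrightarrow> w i > 0"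
  shows "ereal t \<le> quantile \<tau> (weighted_point_masses I w v) \<longleftrightarrow>
    (\<Sum>i\<in>I. if v i < t then w i else 0) < \<tau> * (\<Sum>i\<in>I. w i)"
proof -
  define F where "F x = (\<Sum>i\<in>I. if v i \<le> x then w i else 0)" for x
  define L where "L = (\<Sum>i\<in>I. if v i < t then w i else 0)"
  define W where "W = (\<Sum>i\<in>I. w i)"
  have "W > 0"
    unfolding W_def using assms by (intro sum_pos) auto
  have "ereal t \<le> quantile \<tau> (weighted_point_masses I w v) \<longleftrightarrow> (\<forall>x. \<tau> * W \<le> F x \<longrightarrow> t \<le> x)"
    using \<open>W > 0\<close> measure_weighted_point_masses_atMost[OF assms(1) pos]
    by (auto simp: quantile_def le_Inf_iff pos_le_divide_eq F_def W_def)
  also have "\<dots> \<longleftrightarrow> L < \<tau> * W"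
  proof
    assume *: "\<forall>x. \<tau> * W \<le> F x \<longrightarrow> t \<le> x"
    \<comment> \<open>The point \<open>t - 1\<close> only ensures that the maximum exists.\<close>
    define A where "A = insert (t - 1) (v ` {i \<in> I. v i < t})"
    have "finite A" "A \<noteq> {}"
      using assms(1) by (auto simp: A_def)
    have "Max A < t"
      using \<open>finite A\<close> \<open>A \<noteq> {}\<close> by (auto simp: A_def)
    have "v i \<le> Max A" if "i \<in> I" "v i < t" for i
      using \<open>finite A\<close> that by (intro Max_ge) (auto simp: A_def)
    then have "L \<le> F (Max A)"
      unfolding L_def F_def using pos by (intro sum_mono) (auto intro: less_imp_le)
    then show "L < \<tau> * W"
      using * \<open>Max A < t\<close> by (meson le_less_trans not_le)
  next
    assume *: "L < \<tau> * W"
    have "F x \<le> L" if "x < t" for x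
      unfolding L_def F_def using that pos by (intro sum_mono) (auto intro: less_imp_le)
    then show "\<forall>x. \<tau> * W \<le> F x \<longrightarrow> t \<le> x"
      using * by (meson le_less_trans not_le)
  qed
  finally show ?thesis
    by (simp add: L_def W_def)
qed

text \<open>
  The condition on \<open>i\<close> is that \<open>v i\<close> is at most the \<open>\<tau>\<close>-quantile, so this is the fact that
  an index drawn with probabilities proportional to \<open>w\<close> satisfies it with probability at least
  \<open>\<tau>\<close>. If some index violates it, take one with the smallest value: since it is above the
  quantile, the indices of strictly smaller value carry a share of at least \<open>\<tau>\<close>, and by
  minimality they all satisfy the condition.
\<close>

lemma sum_weights_below_level_ge:
  fixes w v :: "'i \<Rightarrow> real"
  assumes "finite I" and nonneg: "\<And>i. i \<in> I \<Longrightarrow> w i \<ge> 0" and "\<tau> \<le> 1"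
  shows "\<tau> * (\<Sum>i\<in>I. w i) \<le>
    (\<Sum>i\<in>I. if (\<Sum>j\<in>I. if v j < v i then w j else 0) < \<tau> * (\<Sum>j\<in>I. w j) then w i else 0)"
    (is "?c \<le> (\<Sum>i\<in>I. if ?L i < ?c then w i else 0)")
proof (cases "\<exists>i\<in>I. ?c \<le> ?L i")
  case False
  then have "(\<Sum>i\<in>I. if ?L i < ?c then w i else 0) = (\<Sum>i\<in>I. w i)"
    by (intro sum.cong) (auto simp: not_le)
  then show ?thesis
    using mult_right_mono[OF \<open>\<tau> \<le> 1\<close> sum_nonneg[OF nonneg]] by simp
next
  case True
  define B where "B = {i \<in> I. ?c \<le> ?L i}"
  have "finite B" "B \<noteq> {}"
    using True assms(1) by (auto simp: B_def)
  then obtain k where k: "k \<in> B" "\<And>i. i \<in> B \<Longrightarrow> v k \<le> v i"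
    using ex_min_if_finite[of "v ` B"] by (auto simp: not_less)
  have "?c \<le> ?L k"
    using k(1) by (simp add: B_def)
  also have "\<dots> \<le> (\<Sum>i\<in>I. if ?L i < ?c then w i else 0)"
  proof (rule sum_mono)
    fix i assume i: "i \<in> I"
    show "(if v i < v k then w i else 0) \<le> (if ?L i < ?c then w i else 0)"
      using k(2)[of i] nonneg[OF i] i by (auto simp: B_def)
  qed
  finally show ?thesis .
qed

section \<open>Averaging over measure-preserving maps\<close>

lemma nn_integral_invariant:
  assumes "T \<in> measurable \<mu> \<mu>" "distr \<mu> \<mu> T = \<mu>" "g \<in> borel_measurable \<mu>"
  shows "(\<integral>\<^sup>+z. g (T z) \<partial>\<mu>) = (\<integral>\<^sup>+z. g z \<partial>\<mu>)"
  using nn_integral_distr[OF assms(1), of g] assms(2,3) by simp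

text \<open>
  By invariance, the integrals of \<open>f (T i z)\<close>, and likewise those of its restriction to \<open>G\<close>, do not
  depend on \<open>i\<close>. Integrating the bound for the sums over \<open>i\<close> thus gives \<open>card I\<close> times
  the claim. This takes the place of conditioning on an orbit.
\<close>

lemma emeasure_density_ge_of_orbit_bound:
  fixes f :: "'a \<Rightarrow> real"
  assumes "finite I" "I \<noteq> {}"
    and T: "\<And>i. i \<in> I \<Longrightarrow> T i \<in> measurable \<mu> \<mu>" "\<And>i. i \<in> I \<Longrightarrow> distr \<mu> \<mu> (T i) = \<mu>"
    and f [measurable]: "f \<in> borel_measurable \<mu>" and nonneg: "\<And>z. z \<in> space \<mu> \<Longrightarrow> f z \<ge> 0"
    and prob: "(\<integral>\<^sup>+z. ennreal (f z) \<partial>\<mu>) = 1"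
    and G [measurable]: "Measurable.pred \<mu> G"
    and "c \<ge> 0"
    and orbit: "\<And>z. z \<in> space \<mu> \<Longrightarrow>
      c * (\<Sum>i\<in>I. f (T i z)) \<le> (\<Sum>i\<in>I. if G (T i z) then f (T i z) else 0)"
  shows "ennreal c \<le> emeasure (density \<mu> f) {z \<in> space \<mu>. G z}"
proof -
  define h where "h z = (if G z then f z else 0)" for z
  have h [measurable]: "h \<in> borel_measurable \<mu>"
    unfolding h_def by measurable
  have meas [measurable]: "(\<lambda>z. f (T i z)) \<in> borel_measurable \<mu>" "(\<lambda>z. h (T i z)) \<in> borel_measurable \<mu>"
    if "i \<in> I" for i
    using T(1)[OF that] by measurable
  have nonneg': "f (T i z) \<ge> 0" "h (T i z) \<ge> 0" if "i \<in> I" "z \<in> space \<mu>" for i z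
    using nonneg[OF measurable_space[OF T(1)[OF that(1)] that(2)]] by (auto simp: h_def)
  have sum_integral: "(\<integral>\<^sup>+z. ennreal (\<Sum>i\<in>I. g (T i z)) \<partial>\<mu>) = of_nat (card I) * (\<integral>\<^sup>+z. ennreal (g z) \<partial>\<mu>)"
    if [measurable]: "g \<in> borel_measurable \<mu>"
      and "\<And>i z. i \<in> I \<Longrightarrow> z \<in> space \<mu> \<Longrightarrow> g (T i z) \<ge> 0" for g :: "'a \<Rightarrow> real"
  proof -
    have "(\<integral>\<^sup>+z. ennreal (\<Sum>i\<in>I. g (T i z)) \<partial>\<mu>) = (\<integral>\<^sup>+z. (\<Sum>i\<in>I. ennreal (g (T i z))) \<partial>\<mu>)"
      using that(2) by (intro nn_integral_cong sum_ennreal[symmetric]) auto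
    also have "\<dots> = (\<Sum>i\<in>I. \<integral>\<^sup>+z. ennreal (g (T i z)) \<partial>\<mu>)"
      using measurable_compose[OF T(1) that(1)]
      by (intro nn_integral_sum measurable_compose[OF _ measurable_ennreal]) auto
    also have "\<dots> = (\<Sum>i\<in>I. \<integral>\<^sup>+z. ennreal (g z) \<partial>\<mu>)"
      using T by (intro sum.cong refl nn_integral_invariant[where g = "\<lambda>z. ennreal (g z)"]) auto
    finally show ?thesis by simp
  qed
  have "of_nat (card I) * ennreal c = ennreal c * (\<integral>\<^sup>+z. ennreal (\<Sum>i\<in>I. f (T i z)) \<partial>\<mu>)"
    using sum_integral[OF f nonneg'(1)] prob by (simp add: mult.commute)
  also have "\<dots> = (\<integral>\<^sup>+z. ennreal c * ennreal (\<Sum>i\<in>I. f (T i z)) \<partial>\<mu>)"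
    by (intro nn_integral_cmult[symmetric]) measurable
  also have "\<dots> \<le> (\<integral>\<^sup>+z. ennreal (\<Sum>i\<in>I. h (T i z)) \<partial>\<mu>)"
    using orbit \<open>c \<ge> 0\<close> nonneg'(1)
    by (intro nn_integral_mono) (simp add: h_def sum_nonneg ennreal_leI flip: ennreal_mult)
  also have "\<dots> = of_nat (card I) * (\<integral>\<^sup>+z. ennreal (h z) \<partial>\<mu>)"
    by (rule sum_integral[OF h nonneg'(2)])
  also have "(\<integral>\<^sup>+z. ennreal (h z) \<partial>\<mu>) = emeasure (density \<mu> f) {z \<in> space \<mu>. G z}"
    by (subst emeasure_density) (auto intro!: nn_integral_cong simp: h_def)
  finally show ?thesis
    using assms(1,2) by (simp add: ennreal_mult_le_mult_iff of_nat_less_top)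
qed

section \<open>Permuted vectors\<close>

lemma permute_vec_permute_vec:
  assumes "\<tau> permutes {1..n+1}"
  shows "permute_vec n \<tau> (permute_vec n \<sigma> z) = permute_vec n (\<sigma> \<circ> \<tau>) z"
  using permutes_in_image[OF assms] by (auto simp: permute_vec_def restrict_def fun_eq_iff)

lemma permute_vec_measurable:
  assumes "\<sigma> permutes {1..n+1}"
  shows "permute_vec n \<sigma> \<in> measurable (PiM {1..n+1} (\<lambda>_. N)) (PiM {1..n+1} (\<lambda>_. N))"
proof -
  have "(\<lambda>z. \<lambda>i\<in>{1..n+1}. z (\<sigma> i)) \<in> measurable (PiM {1..n+1} (\<lambda>_. N)) (PiM {1..n+1} (\<lambda>_. N))"
    using permutes_in_image[OF assms]
    by (intro measurable_restrict measurable_component_singleton) auto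
  then show ?thesis
    by (simp add: permute_vec_def[abs_def])
qed

text \<open>
  Composition with \<open>\<sigma>\<close> is a bijection of the symmetric group, so moving along an orbit
  does not change a sum over the orbit.
\<close>

lemma sum_permute_vec_permute_vec:
  assumes "\<sigma> permutes {1..n+1}"
  shows "(\<Sum>\<tau> | \<tau> permutes {1..n+1}. g (permute_vec n \<tau> (permute_vec n \<sigma> z))) =
    (\<Sum>\<tau> | \<tau> permutes {1..n+1}. g (permute_vec n \<tau> z))"
proof -
  have "(\<Sum>\<tau> | \<tau> permutes {1..n+1}. g (permute_vec n \<tau> z)) =
      (\<Sum>\<tau> | \<tau> permutes {1..n+1}. g (permute_vec n (\<sigma> \<circ> \<tau>) z))"
    by (rule setum_permutations_compose_left[OF assms])
  also have "\<dots> = (\<Sum>\<tau> | \<tau> permutes {1..n+1}. g (permute_vec n \<tau> (permute_vec n \<sigma> z)))"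
    by (intro sum.cong refl) (simp add: permute_vec_permute_vec)
  finally show ?thesis ..
qed

section \<open>Coverage\<close>

theorem theorem14:
  fixes M :: "'w measure" and MX :: "'x measure" and MY :: "'y measure"
    and \<mu> :: "(nat \<Rightarrow> 'x \<times> 'y) measure"
    and X :: "nat \<Rightarrow> 'w \<Rightarrow> 'x" and Y :: "nat \<Rightarrow> 'w \<Rightarrow> 'y"
    and f :: "(nat \<Rightarrow> 'x \<times> 'y) \<Rightarrow> real"
    and s :: "'x \<times> 'y \<Rightarrow> (nat \<Rightarrow> 'x \<times> 'y) \<Rightarrow> real"
    and n :: nat and \<alpha> :: real
  assumes "prob_space M"
    and "n \<ge> 1"
    and "\<alpha> \<in> {0..1}"
    and "exchangeable_measure n (MX \<Otimes>\<^sub>M MY) \<mu>"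
    and "\<And>z. z \<in> space \<mu> \<Longrightarrow> f z > 0"
    and "distributed M \<mu> (\<lambda>\<omega>. \<lambda>i\<in>{1..n+1}. (X i \<omega>, Y i \<omega>)) (\<lambda>z. ennreal (f z))"
    and "(\<lambda>(z, zs). s z zs) \<in>
      borel_measurable ((MX \<Otimes>\<^sub>M MY) \<Otimes>\<^sub>M (PiM {1..n+1} (\<lambda>_. MX \<Otimes>\<^sub>M MY)))"
  shows "measure M {\<omega> \<in> space M. Y (n + 1) \<omega> \<in>
      conformal_set n MY f s \<alpha> (\<lambda>i\<in>{1..n}. (X i \<omega>, Y i \<omega>)) (X (n + 1) \<omega>)} \<ge> 1 - \<alpha>"
proof -
  interpret prob_space M by fact
  define Z where "Z \<omega> = (\<lambda>i\<in>{1..n+1}. (X i \<omega>, Y i \<omega>))" for \<omega>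
  define S where "S = {\<sigma>. \<sigma> permutes {1..n+1}}"
  define v where "v z = s (z (n + 1)) z" for z
  \<comment> \<open>The event that \<open>z\<close> is covered, with the quantile eliminated.\<close>
  define G where "G z \<longleftrightarrow>
    (\<Sum>\<sigma>\<in>S. if v (permute_vec n \<sigma> z) < v z then f (permute_vec n \<sigma> z) else 0) <
      (1 - \<alpha>) * (\<Sum>\<sigma>\<in>S. f (permute_vec n \<sigma> z))" for z

  have S: "finite S" "id \<in> S"
    by (auto simp: S_def finite_permutations permutes_id)
  have sets_\<mu>: "sets \<mu> = sets (PiM {1..n+1} (\<lambda>_. MX \<Otimes>\<^sub>M MY))"
    and invariant: "\<And>\<sigma>. \<sigma> \<in> S \<Longrightarrow> distr \<mu> \<mu> (permute_vec n \<sigma>) = \<mu>"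
    using assms(4) by (auto simp: exchangeable_measure_def S_def)
  have space_\<mu>: "space \<mu> = (\<Pi>\<^sub>E i\<in>{1..n+1}. space MX \<times> space MY)"
    using sets_eq_imp_space_eq[OF sets_\<mu>] by (simp add: space_PiM space_pair_measure)
  have perm: "permute_vec n \<sigma> \<in> measurable \<mu> \<mu>" if "\<sigma> \<in> S" for \<sigma>
    using permute_vec_measurable[of \<sigma> n "MX \<Otimes>\<^sub>M MY"] that
    by (simp add: S_def measurable_cong_sets[OF sets_\<mu> sets_\<mu>])
  have Z: "Z \<in> measurable M \<mu>" and distr_Z: "distr M \<mu> Z = density \<mu> (\<lambda>z. ennreal (f z))"
    and ennreal_f: "(\<lambda>z. ennreal (f z)) \<in> borel_measurable \<mu>"
    using assms(6) by (auto simp: distributed_def Z_def[abs_def])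

  \<comment> \<open>Only \<open>ennreal \<circ> f\<close> is measurable by assumption; positivity gives back \<open>f\<close> itself.\<close>
  have f: "f \<in> borel_measurable \<mu>"
  proof -
    have "(\<lambda>z. enn2real (ennreal (f z))) \<in> borel_measurable \<mu>"
      using ennreal_f by measurable
    moreover have "enn2real (ennreal (f z)) = f z" if "z \<in> space \<mu>" for z
      using assms(5)[OF that] by simp
    ultimately show ?thesis
      by (simp cong: measurable_cong)
  qed
  have v: "v \<in> borel_measurable \<mu>"
  proof -
    have "(\<lambda>z. (z (n + 1), z)) \<in> measurable (PiM {1..n+1} (\<lambda>_. MX \<Otimes>\<^sub>M MY))
        ((MX \<Otimes>\<^sub>M MY) \<Otimes>\<^sub>M (PiM {1..n+1} (\<lambda>_. MX \<Otimes>\<^sub>M MY)))"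
      by (intro measurable_Pair measurable_component_singleton measurable_ident) auto
    from measurable_compose[OF this assms(7)] show ?thesis
      by (simp add: v_def[abs_def] measurable_cong_sets[OF sets_\<mu> refl])
  qed
  have G_measurable: "Measurable.pred \<mu> G"
  proof -
    note [measurable] = f v measurable_compose[OF perm f] measurable_compose[OF perm v]
    show ?thesis
      unfolding G_def[abs_def] by measurable
  qed

  \<comment> \<open>The event that \<open>z\<^sub>\<sigma>\<close> is covered compares the score of \<open>z\<^sub>\<sigma>\<close> with quantities that
    depend on the orbit of \<open>z\<close> alone.\<close>
  have G_permute: "G (permute_vec n \<sigma> z) \<longleftrightarrow>
      (\<Sum>\<tau>\<in>S. if v (permute_vec n \<tau> z) < v (permute_vec n \<sigma> z) then f (permute_vec n \<tau> z) else 0) <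
        (1 - \<alpha>) * (\<Sum>\<tau>\<in>S. f (permute_vec n \<tau> z))" if "\<sigma> \<in> S" for \<sigma> z
    using that sum_permute_vec_permute_vec[of \<sigma> n f z]
      sum_permute_vec_permute_vec[of \<sigma> n "\<lambda>u. if v u < v (permute_vec n \<sigma> z) then f u else 0" z]
    by (simp add: G_def S_def)

  have "ennreal (1 - \<alpha>) \<le> emeasure (density \<mu> f) {z \<in> space \<mu>. G z}"
  proof (rule emeasure_density_ge_of_orbit_bound[where T = "permute_vec n" and I = S])
    show "(\<integral>\<^sup>+z. ennreal (f z) \<partial>\<mu>) = 1"
    proof -
      interpret D: prob_space "density \<mu> (\<lambda>z. ennreal (f z))"
        using prob_space_distr[OF Z] by (simp add: distr_Z)
      have "(\<integral>\<^sup>+z. ennreal (f z) \<partial>\<mu>) = emeasure (density \<mu> f) (space \<mu>)"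
        using ennreal_f by (subst emeasure_density) (auto intro!: nn_integral_cong)
      then show ?thesis
        using D.emeasure_space_1 by simp
    qed
    show "(1 - \<alpha>) * (\<Sum>\<sigma>\<in>S. f (permute_vec n \<sigma> z)) \<le>
        (\<Sum>\<sigma>\<in>S. if G (permute_vec n \<sigma> z) then f (permute_vec n \<sigma> z) else 0)"
      if "z \<in> space \<mu>" for z
    proof -
      have "f (permute_vec n \<sigma> z) \<ge> 0" if "\<sigma> \<in> S" for \<sigma>
        using assms(5)[OF measurable_space[OF perm[OF that] \<open>z \<in> space \<mu>\<close>]] by simp
      from sum_weights_below_level_ge[OF S(1) this,
          where \<tau> = "1 - \<alpha>" and v = "\<lambda>\<sigma>. v (permute_vec n \<sigma> z)"]
      show ?thesis
        using assms(3) by (simp add: G_permute cong: sum.cong)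
    qed
  qed (use S perm invariant f assms(3,5) G_measurable in \<open>auto intro: less_imp_le\<close>)
  also have "\<dots> = emeasure M {\<omega> \<in> space M. G (Z \<omega>)}"
  proof -
    have "Z -` {z \<in> space \<mu>. G z} \<inter> space M = {\<omega> \<in> space M. G (Z \<omega>)}"
      using measurable_space[OF Z] by auto
    moreover have "{z \<in> space \<mu>. G z} \<in> sets \<mu>"
      using G_measurable by measurable
    ultimately show ?thesis
      using emeasure_distr[OF Z, of "{z \<in> space \<mu>. G z}"] by (simp add: distr_Z)
  qed
  also have "{\<omega> \<in> space M. G (Z \<omega>)} = {\<omega> \<in> space M. Y (n + 1) \<omega> \<in>
      conformal_set n MY f s \<alpha> (\<lambda>i\<in>{1..n}. (X i \<omega>, Y i \<omega>)) (X (n + 1) \<omega>)}"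
  proof (intro Collect_cong conj_cong refl)
    fix \<omega> assume "\<omega> \<in> space M"
    then have Z\<omega>: "Z \<omega> \<in> space \<mu>"
      using measurable_space[OF Z] by auto
    then have "Z \<omega> (n + 1) \<in> space MX \<times> space MY"
      unfolding space_\<mu> by (rule PiE_mem) simp
    then have Y: "Y (n + 1) \<omega> \<in> space MY"
      by (simp add: Z_def)
    have aug: "augment n (\<lambda>i\<in>{1..n}. (X i \<omega>, Y i \<omega>)) (X (n + 1) \<omega>) (Y (n + 1) \<omega>) = Z \<omega>"
      by (auto simp: augment_def Z_def fun_eq_iff)
    have score: "perm_score n s (Z \<omega>) = (\<lambda>\<sigma>. v (permute_vec n \<sigma> (Z \<omega>)))"
      by (simp add: perm_score_def v_def fun_eq_iff)
    have permute_id: "permute_vec n id (Z \<omega>) = Z \<omega>"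
      by (auto simp: permute_vec_def Z_def fun_eq_iff)
    have fZ: "f (Z \<omega>) > 0"
      using assms(5)[OF Z\<omega>] .
    have weight_pos: "f (permute_vec n \<sigma> (Z \<omega>)) / f (Z \<omega>) > 0" if "\<sigma> \<in> S" for \<sigma>
      using assms(5)[OF measurable_space[OF perm[OF that] Z\<omega>]] fZ by simp
    have scale: "(if b then x / f (Z \<omega>) else 0) = (if b then x else 0) / f (Z \<omega>)" for b x
      by simp
    have "Y (n + 1) \<omega> \<in> conformal_set n MY f s \<alpha> (\<lambda>i\<in>{1..n}. (X i \<omega>, Y i \<omega>)) (X (n + 1) \<omega>) \<longleftrightarrow>
        ereal (v (Z \<omega>)) \<le> quantile (1 - \<alpha>) (weighted_point_masses S
          (\<lambda>\<sigma>. f (permute_vec n \<sigma> (Z \<omega>)) / f (Z \<omega>)) (\<lambda>\<sigma>. v (permute_vec n \<sigma> (Z \<omega>))))"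
      using Y by (simp only: conformal_set_def Let_def aug score permute_id S_def mem_Collect_eq
        simp_thms)
    also have "\<dots> \<longleftrightarrow>
        (\<Sum>\<sigma>\<in>S. if v (permute_vec n \<sigma> (Z \<omega>)) < v (Z \<omega>)
          then f (permute_vec n \<sigma> (Z \<omega>)) / f (Z \<omega>) else 0) <
        (1 - \<alpha>) * (\<Sum>\<sigma>\<in>S. f (permute_vec n \<sigma> (Z \<omega>)) / f (Z \<omega>))"
      using S by (intro le_quantile_weighted_point_masses_iff weight_pos) auto
    also have "\<dots> \<longleftrightarrow> G (Z \<omega>)"
      using fZ by (simp add: G_def scale divide_less_cancel flip: sum_divide_distrib)
    finally show "G (Z \<omega>) \<longleftrightarrow> Y (n + 1) \<omega> \<in>
        conformal_set n MY f s \<alpha> (\<lambda>i\<in>{1..n}. (X i \<omega>, Y i \<omega>)) (X (n + 1) \<omega>)" ..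
  qed
  finally show ?thesis
    by (simp add: emeasure_eq_measure)
qed

end
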